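(* Let $R:\widehat{\mathbb{C}}\to\widehat{\mathbb{C}}$ be a rational map of degree at least two which has a superattracting fixed point in $\widehat{\mathbb{C}}$. Then $R$ has a fixed point in $\widehat{\mathbb{C}}$ whose multiplier $\lambda$ satisfies $\operatorname{Re}(\lambda)\geq 1$. In particular, every polynomial $P$ with complex coefficients and degree at least two has a fixed point $z_0\in\mathbb{C}$ with $\operatorname{Re}(P'(z_0))\geq 1$.
   Context: $\widehat{\mathbb{C}}=\mathbb{C}\cup\{\infty\}$ is the Riemann sphere. A rational map is $R=P/Q$ with $P,Q$ polynomials with complex coefficients without common factor; its degree is $\max(\deg P,\deg Q)$. A point $z_0\in\widehat{\mathbb{C}}$ is a fixed point of $R$ if $R(z_0)=z_0$. The multiplier of a fixed point $z_0\in\mathbb{C}$ is $R'(z_0)$; if $R(\infty)=\infty$, the multiplier of $\infty$ is $h'(0)$, where $h(z)=1/R(1/z)$. A fixed point is called superattracting if its multiplier is $0$. By a fixed point of a polynomial, a finite fixed point (in $\mathbb{C}$) is meant. *)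

theory Defs
  imports "HOL-Analysis.Analysis" "HOL-Computational_Algebra.Computational_Algebra"
begin

(* The Riemann sphere as a point set: "Some z" is the finite point z, "None" is infinity
   (the same encoding as Alexandroff_compactification). *)
type_synonym sphere = "complex option"

(* With d = max (degree P) (degree Q), P(z)/Q(z) = (P(z)/z^d)/(Q(z)/z^d) and the numerator and
   denominator tend to coeff P d and coeff Q d as z goes to infinity; this gives the value at
   infinity.  For coprime P and Q no case is of the form 0/0. *)
definition rat_map :: "complex poly \<Rightarrow> complex poly \<Rightarrow> sphere \<Rightarrow> sphere" where
  "rat_map P Q x =
     (case x of
        Some z \<Rightarrow> (if poly Q z = 0 then None else Some (poly P z / poly Q z))
      | None \<Rightarrow>
          (let d = max (degree P) (degree Q)
           in if coeff Q d = 0 then None else Some (coeff P d / coeff Q d)))"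

definition rational_map :: "nat \<Rightarrow> (sphere \<Rightarrow> sphere) \<Rightarrow> bool" where
  "rational_map d R \<longleftrightarrow>
     (\<exists>P Q. Q \<noteq> 0 \<and> coprime P Q \<and> d = max (degree P) (degree Q) \<and> R = rat_map P Q)"

definition sphere_inv :: "sphere \<Rightarrow> sphere" where
  "sphere_inv x =
     (case x of
        Some z \<Rightarrow> (if z = 0 then None else Some (1 / z))
      | None \<Rightarrow> Some 0)"

definition fixed_point :: "(sphere \<Rightarrow> sphere) \<Rightarrow> sphere \<Rightarrow> bool" where
  "fixed_point R x \<longleftrightarrow> R x = x"

(* Only meaningful at a fixed point x of a rational map R: there the functions under deriv are
   finite near the base point, so the value of "the" at None plays no role.  In the second case
   the function is h(w) = 1/R(1/w), with h(0) = 0. *)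
definition multiplier :: "(sphere \<Rightarrow> sphere) \<Rightarrow> sphere \<Rightarrow> complex" where
  "multiplier R x =
     (case x of
        Some z \<Rightarrow> deriv (\<lambda>w. the (R (Some w))) z
      | None \<Rightarrow> deriv (\<lambda>w. the (sphere_inv (R (sphere_inv (Some w))))) 0)"

definition superattracting :: "(sphere \<Rightarrow> sphere) \<Rightarrow> sphere \<Rightarrow> bool" where
  "superattracting R x \<longleftrightarrow> fixed_point R x \<and> multiplier R x = 0"

end

theory Submission
  imports Defs
begin

text \<open>
  If $z$ is a finite fixed point of $R = P/Q$ and $F = zQ - P$, then $1 - R'(z) = F'(z)/Q(z)$, so
  the fixed point formula $\sum 1/(1 - \lambda) = 1$ reduces to Lagrange interpolation of $Q$ at
  the roots of $F$; the fixed point at infinity accounts for the drop of the degree of $F$.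
  If all multipliers had real part less than $1$, every term of the sum would have positive real
  part, while the superattracting fixed point alone already contributes $1$.
\<close>

section \<open>Lagrange interpolation at simple roots\<close>

lemma card_roots_rsquarefree:
  fixes F :: "complex poly"
  assumes "rsquarefree F"
  shows "card {z. poly F z = 0} = degree F"
proof -
  have F0: "F \<noteq> 0" using assms by (simp add: rsquarefree_def)
  have "degree F = (\<Sum>z | poly F z = 0. count (proots F) z)"
    using F0 by (simp flip: size_proots_complex add: size_multiset_overloaded_eq)
  also have "\<dots> = (\<Sum>z | poly F z = 0. 1)"
    using F0 rsquarefree_root_order[OF assms] by (intro sum.cong) auto
  finally show ?thesis by simp
qed

text \<open>Lagrange interpolation at the roots of \<open>F\<close> writes \<open>G\<close> as the
  sum of \<open>G(z) / F'(z)\<close> times \<open>F / (X - z)\<close>. Each quotient has degree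
  \<open>degree F - 1\<close> and the leading coefficient of \<open>F\<close>; comparing
  coefficients in that degree gives the formula.\<close>

lemma sum_div_pderiv_roots:
  fixes F G :: "complex poly"
  assumes rsq: "rsquarefree F"
    and deg: "degree G < degree F"
  shows "(\<Sum>z | poly F z = 0. poly G z / poly (pderiv F) z)
           = coeff G (degree F - 1) / lead_coeff F"
proof -
  define n where "n = degree F"
  define A where "A = {z. poly F z = 0}"
  define S where "S = synthetic_div F"
  have F0: "F \<noteq> 0" using deg by auto
  have fin: "finite A" unfolding A_def using F0 by (rule poly_roots_finite)
  have simple: "poly (pderiv F) z \<noteq> 0" if "poly F z = 0" for z
    using rsq that unfolding rsquarefree_roots by blast
  have card: "card A = n"
    unfolding A_def n_def using rsq by (rule card_roots_rsquarefree)
  have FS: "F = [:- z, 1:] * S z" if "z \<in> A" for z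
    using synthetic_div_correct'[of z F] that by (simp add: S_def A_def)
  have degS: "degree (S z) = n - 1" for z
    by (simp add: S_def n_def degree_synthetic_div)
  \<comment> \<open>Differentiating \<open>F = (X - z) * S z\<close> and evaluating at
    \<open>z\<close> kills the term that keeps the factor \<open>X - z\<close>.\<close>
  have S_self: "poly (S z) z = poly (pderiv F) z" if "z \<in> A" for z
    by (subst FS[OF that]) (simp add: pderiv_mult pderiv_pCons del: mult_pCons_left)
  have S_other: "poly (S z) w = 0" if "z \<in> A" "w \<in> A" "w \<noteq> z" for z w
  proof -
    have "poly ([:- z, 1:] * S z) w = 0" using FS[OF that(1)] that(2) by (simp add: A_def)
    then show ?thesis using that(3) by simp
  qed
  have coeffS: "coeff (S z) (n - 1) = lead_coeff F" if "z \<in> A" for z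
  proof -
    have "lead_coeff F = lead_coeff [:- z, 1:] * lead_coeff (S z)"
      using FS[OF that] lead_coeff_mult by metis
    then show ?thesis by (simp add: degS)
  qed
  define L where "L = (\<Sum>z\<in>A. smult (poly G z / poly (pderiv F) z) (S z))"
  \<comment> \<open>Both sides have degree below \<open>n\<close> and agree at the \<open>n\<close>
    points of \<open>A\<close>.\<close>
  have "G = L"
  proof (rule poly_eqI_degree[of A])
    fix w assume w: "w \<in> A"
    have "poly L w = (\<Sum>z\<in>A. poly G z / poly (pderiv F) z * poly (S z) w)"
      by (simp add: L_def poly_sum)
    also have "\<dots> = (\<Sum>z\<in>A. if z = w then poly G w else 0)"
    proof (rule sum.cong[OF refl])
      fix z assume "z \<in> A"
      then show "poly G z / poly (pderiv F) z * poly (S z) w = (if z = w then poly G w else 0)"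
        using w S_self[of w] S_other[of z w] simple[of w] by (auto simp: A_def)
    qed
    also have "\<dots> = poly G w" using w fin by simp
    finally show "poly G w = poly L w" ..
  next
    show "card A > degree G" using card deg by (simp add: n_def)
    have "degree L \<le> n - 1"
      unfolding L_def by (rule degree_sum_le[OF fin]) (use degS degree_smult_le in \<open>metis\<close>)
    then show "card A > degree L" using card deg by (simp add: n_def)
  qed
  then have "coeff G (n - 1) = coeff L (n - 1)" by simp
  also have "\<dots> = (\<Sum>z\<in>A. poly G z / poly (pderiv F) z * lead_coeff F)"
    unfolding L_def coeff_sum by (rule sum.cong) (simp_all only: coeff_smult coeffS)
  also have "\<dots> = (\<Sum>z\<in>A. poly G z / poly (pderiv F) z) * lead_coeff F"
    by (simp add: sum_distrib_right)
  finally show ?thesis using F0 by (simp add: A_def n_def)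
qed

section \<open>Fixed points and multipliers in terms of \<open>P\<close> and
  \<open>Q\<close>\<close>

text \<open>Where \<open>X * Q - P\<close> vanishes, a zero of \<open>Q\<close> would also be a zero
  of \<open>P\<close>, which coprimality excludes; so \<open>z\<close> is not a pole there.\<close>

lemma fixed_point_Some_iff:
  assumes "coprime P Q"
  shows "fixed_point (rat_map P Q) (Some z) \<longleftrightarrow> poly ([:0, 1:] * Q - P) z = 0"
  using coprime_poly_0[OF assms, of z]
  by (auto simp: fixed_point_def rat_map_def field_simps)

lemma fixed_point_None_iff:
  "fixed_point (rat_map P Q) None \<longleftrightarrow> coeff Q (max (degree P) (degree Q)) = 0"
  by (simp add: fixed_point_def rat_map_def Let_def)

lemma multiplier_Some:
  assumes "poly Q z \<noteq> 0"
  shows "multiplier (rat_map P Q) (Some z) =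
    (poly (pderiv P) z * poly Q z - poly P z * poly (pderiv Q) z) / (poly Q z * poly Q z)"
proof -
  have "open {w. poly Q w \<noteq> 0}"
    by (intro open_Collect_neq continuous_intros)
  then have "\<forall>\<^sub>F w in nhds z. poly Q w \<noteq> 0"
    using assms eventually_nhds by blast
  then have "\<forall>\<^sub>F w in nhds z. the (rat_map P Q (Some w)) = poly P w / poly Q w"
    by (rule eventually_mono) (simp add: rat_map_def)
  then have "multiplier (rat_map P Q) (Some z) = deriv (\<lambda>w. poly P w / poly Q w) z"
    unfolding multiplier_def by (simp add: deriv_cong_ev)
  also have "\<dots> = (poly (pderiv P) z * poly Q z - poly P z * poly (pderiv Q) z)
      / (poly Q z * poly Q z)"
    by (rule DERIV_imp_deriv) (use assms in \<open>intro DERIV_divide poly_DERIV\<close>)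
  finally show ?thesis .
qed

text \<open>Substituting \<open>P(z) = z Q(z)\<close> into the quotient rule cancels one factor
  \<open>Q(z)\<close> and leaves the multiplier \<open>(P'(z) - z Q'(z)) / Q(z)\<close>, while
  \<open>(X Q - P)' = Q + X Q' - P'\<close>.\<close>

lemma one_minus_multiplier_Some:
  assumes "coprime P Q" and fixed: "fixed_point (rat_map P Q) (Some z)"
  shows "1 - multiplier (rat_map P Q) (Some z)
           = poly (pderiv ([:0, 1:] * Q - P)) z / poly Q z"
proof -
  have Pz: "poly P z = z * poly Q z"
    using fixed_point_Some_iff[OF assms(1)] fixed by simp
  then have Qz: "poly Q z \<noteq> 0" using coprime_poly_0[OF assms(1), of z] by auto
  show ?thesis
    unfolding multiplier_Some[OF Qz] Pz using Qz
    by (simp add: pderiv_mult pderiv_diff pderiv_pCons field_simps)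
qed

text \<open>In terms of the reversed polynomials, \<open>1 / R(1 / w) = w * g w\<close> near 0 with
  \<open>g\<close> differentiable at 0, so the multiplier is \<open>g 0\<close>.\<close>

lemma multiplier_None:
  assumes "degree Q < degree P"
  shows "multiplier (rat_map P Q) None = coeff Q (degree P - 1) / lead_coeff P"
proof -
  define k where "k = degree P - 1 - degree Q"
  define p where "p = reflect_poly P"
  define g where "g w = w ^ k * poly (reflect_poly Q) w / poly p w" for w
  have P0: "P \<noteq> 0" using assms by auto
  have p0: "poly p 0 \<noteq> 0" using P0 by (simp add: p_def)
  have dP: "degree P = Suc (k + degree Q)" using assms by (simp add: k_def)
  have "open {w. poly p w \<noteq> 0}"
    by (intro open_Collect_neq continuous_intros)
  then have "\<forall>\<^sub>F w in nhds 0. poly p w \<noteq> 0"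
    using p0 eventually_nhds by blast
  then have "\<forall>\<^sub>F w in nhds 0. the (sphere_inv (rat_map P Q (sphere_inv (Some w)))) = w * g w"
  proof (rule eventually_mono)
    fix w assume pw: "poly p w \<noteq> 0"
    show "the (sphere_inv (rat_map P Q (sphere_inv (Some w)))) = w * g w"
    proof (cases "w = 0")
      case True
      have "max (degree P) (degree Q) = degree P" using assms by simp
      then show ?thesis
        using True assms by (simp add: sphere_inv_def rat_map_def Let_def coeff_eq_0)
    next
      case False
      have 1: "poly p w = w ^ degree P * poly P (1 / w)"
        using False by (simp add: p_def poly_reflect_poly_nz inverse_eq_divide)
      have 2: "poly (reflect_poly Q) w = w ^ degree Q * poly Q (1 / w)"
        using False by (simp add: poly_reflect_poly_nz inverse_eq_divide)
      have "poly P (1 / w) \<noteq> 0" using 1 pw by auto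
      then show ?thesis
        using False unfolding g_def 1 2 dP
        by (simp add: sphere_inv_def rat_map_def power_add)
    qed
  qed
  then have "multiplier (rat_map P Q) None = deriv (\<lambda>w. w * g w) 0"
    unfolding multiplier_def by (simp add: deriv_cong_ev)
  also have "\<dots> = g 0"
  proof -
    have "g field_differentiable at 0"
      unfolding g_def using p0
      by (intro derivative_intros field_differentiable_divide field_differentiable_mult
          field_differentiable_power) (auto simp: field_differentiable_def intro: poly_DERIV)
    then obtain g' where "(g has_field_derivative g') (at 0)"
      by (auto simp: field_differentiable_def)
    from DERIV_mult[OF DERIV_ident this] show ?thesis by (simp add: DERIV_imp_deriv)
  qed
  \<comment> \<open>If \<open>k = 0\<close>, then \<open>degree P - 1\<close> is the degree of
    \<open>Q\<close> and \<open>g 0\<close> is the ratio of the leading coefficients. Otherwise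
    \<open>w ^ k\<close> vanishes at 0 and \<open>degree P - 1\<close> exceeds the degree of
    \<open>Q\<close>, so both sides are 0.\<close>
  also have "g 0 = coeff Q (degree P - 1) / lead_coeff P"
  proof (cases k)
    case 0
    then show ?thesis by (simp add: g_def p_def dP)
  next
    case (Suc j)
    then show ?thesis by (simp add: g_def dP coeff_eq_0)
  qed
  finally show ?thesis .
qed

section \<open>The fixed point formula and the contradiction\<close>

text \<open>Inversion preserves the right half-plane, because
  \<open>Re (1 / u) = Re u / |u|^2\<close>.\<close>

lemma Re_inverse_one_minus_pos:
  assumes "Re l < 1"
  shows "Re (1 / (1 - l)) > 0"
proof -
  have "1 - l \<noteq> 0" using assms by auto
  then have "cmod (1 - l) > 0" by simp
  then show ?thesis using assms by (simp add: Re_divide' zero_less_divide_iff)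
qed

text \<open>At a multiple root the derivative vanishes as well, which would make the multiplier
  equal to 1.\<close>

lemma rsquarefree_fixed_point_poly:
  assumes "coprime P Q"
    and ne1: "\<And>z. fixed_point (rat_map P Q) (Some z) \<Longrightarrow> multiplier (rat_map P Q) (Some z) \<noteq> 1"
  shows "rsquarefree ([:0, 1:] * Q - P)"
  unfolding rsquarefree_roots
  using one_minus_multiplier_Some[OF assms(1)] ne1 fixed_point_Some_iff[OF assms(1)]
  by (metis div_0 eq_iff_diff_eq_0)

text \<open>Each term equals \<open>Q(z) / F'(z)\<close>, so interpolation applies with
  \<open>G = Q\<close>. The right-hand side stays in terms of coefficients because its value depends
  on whether infinity is fixed.\<close>

lemma sum_finite_fixed_points:
  assumes cop: "coprime P Q" and F: "F = [:0, 1:] * Q - P" "rsquarefree F" "degree Q < degree F"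
  shows "(\<Sum>z | fixed_point (rat_map P Q) (Some z). 1 / (1 - multiplier (rat_map P Q) (Some z)))
    = coeff Q (degree F - 1) / lead_coeff F"
proof -
  note fp = fixed_point_Some_iff[OF cop, folded F(1)]
  note mult = one_minus_multiplier_Some[OF cop, folded F(1)]
  have "(\<Sum>z | fixed_point (rat_map P Q) (Some z). 1 / (1 - multiplier (rat_map P Q) (Some z)))
    = (\<Sum>z | poly F z = 0. poly Q z / poly (pderiv F) z)"
    by (rule sum.cong) (auto simp: fp mult)
  also have "\<dots> = coeff Q (degree F - 1) / lead_coeff F"
    using F(2,3) by (rule sum_div_pderiv_roots)
  finally show ?thesis .
qed

lemma superattracting_imp_weakly_repelling:
  assumes cop: "coprime P Q" and d: "d = max (degree P) (degree Q)" "d \<ge> 2"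
    and sup: "superattracting (rat_map P Q) x"
  shows "\<exists>y. fixed_point (rat_map P Q) y \<and> Re (multiplier (rat_map P Q) y) \<ge> 1"
proof (rule ccontr)
  let ?R = "rat_map P Q"
  assume "\<not> ?thesis"
  then have lt: "Re (multiplier ?R y) < 1" if "fixed_point ?R y" for y
    using that by force
  define F where "F = [:0, 1:] * Q - P"
  define A where "A = {z. fixed_point ?R (Some z)}"
  define t where "t = (\<lambda>y. 1 / (1 - multiplier ?R y))"
  have t_pos: "Re (t y) > 0" if "fixed_point ?R y" for y
    using Re_inverse_one_minus_pos[OF lt[OF that]] by (simp add: t_def)
  have ne1: "multiplier ?R y \<noteq> 1" if "fixed_point ?R y" for y
    using lt[OF that] by auto
  have tx: "t x = 1" and fx: "fixed_point ?R x"
    using sup by (simp_all add: superattracting_def t_def)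
  have coeffF: "coeff F (Suc i) = coeff Q i - coeff P (Suc i)" for i
    by (simp add: F_def)
  have rsq: "rsquarefree F"
    unfolding F_def using cop ne1 by (rule rsquarefree_fixed_point_poly)
  have sum: "(\<Sum>z\<in>A. t (Some z)) = coeff Q (degree F - 1) / lead_coeff F"
    if "degree Q < degree F"
    using sum_finite_fixed_points[OF cop F_def rsq that] by (simp add: A_def t_def)
  have A_eq: "A = {z. poly F z = 0}"
    by (simp only: A_def F_def fixed_point_Some_iff[OF cop])
  have fin: "finite A"
    unfolding A_eq using rsq by (intro poly_roots_finite) (simp add: rsquarefree_def)
  have cardA: "card A = degree F"
    unfolding A_eq using rsq by (rule card_roots_rsquarefree)
  show False
  proof (cases "fixed_point ?R None")
    case False
    then have Qd: "coeff Q d \<noteq> 0" by (simp add: fixed_point_None_iff d)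
    \<comment> \<open>As \<open>degree P \<le> d\<close>, the top term of \<open>F\<close> comes
      from \<open>X * Q\<close> alone; hence the quotient of coefficients in \<open>sum\<close> is
      1.\<close>
    have Fd: "coeff F (Suc d) = coeff Q d"
      using d by (simp add: coeffF coeff_eq_0)
    have "degree F \<le> Suc d"
      unfolding F_def using d by (intro degree_diff_le) (auto intro: order_trans[OF degree_mult_le])
    moreover have "degree F \<ge> Suc d" using Fd Qd by (intro le_degree) simp
    ultimately have dF: "degree F = Suc d" by simp
    have "(\<Sum>z\<in>A. t (Some z)) = 1"
      using sum dF Fd Qd d by simp
    moreover obtain z where z: "x = Some z" "z \<in> A"
      using fx False by (cases x) (auto simp: A_def)
    moreover have card: "card A \<ge> 2" using cardA dF d by simp
    \<comment> \<open>Removing the superattracting point, whose term is 1, leaves sum 0 over a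
      nonempty set of terms with positive real part.\<close>
    ultimately have "(\<Sum>w\<in>A - {z}. t (Some w)) = 0"
      using tx fin by (simp add: sum.remove)
    then have "(\<Sum>w\<in>A - {z}. Re (t (Some w))) = 0"
      by (metis Re_sum zero_complex.simps(1))
    moreover have "A - {z} \<noteq> {}"
      using card fin z by (metis One_nat_def card.empty card_Diff_singleton diff_is_0_eq
          not_less_eq_eq numeral_2_eq_2)
    then have "(\<Sum>w\<in>A - {z}. Re (t (Some w))) > 0"
      using fin t_pos by (intro sum_pos) (auto simp: A_def)
    ultimately show False by simp
  next
    case True
    then have Qd: "coeff Q d = 0" by (simp add: fixed_point_None_iff d)
    \<comment> \<open>If \<open>degree Q\<close> attained the maximum, \<open>coeff Q d = 0\<close>
      would force \<open>Q = 0\<close> and hence \<open>d = 0\<close>.\<close>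
    have lt_deg: "degree Q < degree P"
      using Qd d by (metis leading_coeff_0_iff degree_0 linorder_not_less max.absorb2
          not_numeral_le_zero)
    then have dP: "d = degree P" using d by simp
    then obtain e where e: "degree P = Suc e" using d(2) by (metis Suc_le_D numeral_2_eq_2)
    define p q where "p = lead_coeff P" and "q = coeff Q e"
    have p0: "p \<noteq> 0" using lt_deg by (auto simp: p_def)
    have mN: "multiplier ?R None = q / p"
      using multiplier_None[OF lt_deg] by (simp add: p_def q_def e)
    \<comment> \<open>The multiplier \<open>q / p\<close> at infinity differs from 1, so the terms
      of degree \<open>d\<close> in \<open>X * Q\<close> and \<open>P\<close> do not cancel and
      \<open>F\<close> has degree exactly \<open>d\<close>.\<close>
    have qp: "q \<noteq> p" using ne1[OF True] mN p0 by auto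
    have Fd: "coeff F d = q - p" using coeffF[of e] dP e by (simp add: p_def q_def)
    have "degree F \<le> d"
      unfolding F_def using lt_deg dP
      by (intro degree_diff_le) (auto intro: order_trans[OF degree_mult_le])
    moreover have "degree F \<ge> d" using Fd qp by (intro le_degree) simp
    ultimately have dF: "degree F = d" by simp
    have "(\<Sum>z\<in>A. t (Some z)) = q / (q - p)"
      using sum dF Fd lt_deg dP e by (simp add: q_def)
    moreover have "t None = p / (p - q)"
      unfolding t_def mN using p0 qp by (simp add: divide_simps)
    moreover have "q / (q - p) + p / (p - q) = 1"
      using qp by (simp add: divide_simps) (simp add: algebra_simps)
    ultimately have total: "(\<Sum>z\<in>A. t (Some z)) + t None = 1"
      by simp
    have A: "A \<noteq> {}" using cardA dF d by auto
    show False
    proof (cases x)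
      case None
      then have "(\<Sum>z\<in>A. t (Some z)) = 0" using total tx by simp
      then have "(\<Sum>z\<in>A. Re (t (Some z))) = 0"
        by (metis Re_sum zero_complex.simps(1))
      moreover have "(\<Sum>z\<in>A. Re (t (Some z))) > 0"
        using fin A t_pos by (intro sum_pos) (auto simp: A_def)
      ultimately show False by simp
    next
      case (Some z)
      then have "z \<in> A" using fx by (simp add: A_def)
      then have "(\<Sum>w\<in>A - {z}. t (Some w)) + t None = 0"
        using total tx Some fin by (simp add: sum.remove)
      \<comment> \<open>The term at infinity is already positive, so the other finite fixed points
        only have to contribute a nonnegative amount.\<close>
      then have "(\<Sum>w\<in>A - {z}. Re (t (Some w))) + Re (t None) = 0"
        by (metis Re_sum plus_complex.simps(1) zero_complex.simps(1))
      moreover have "(\<Sum>w\<in>A - {z}. Re (t (Some w))) \<ge> 0"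
        using t_pos by (intro sum_nonneg) (auto simp: A_def less_imp_le)
      ultimately show False using t_pos[OF True] by simp
    qed
  qed
qed

theorem theorem2p2:
  shows "(\<forall>(R :: sphere \<Rightarrow> sphere) d. rational_map d R \<and> d \<ge> 2 \<and> (\<exists>x. superattracting R x) \<longrightarrow>
            (\<exists>x. fixed_point R x \<and> Re (multiplier R x) \<ge> 1)) \<and>
         (\<forall>P :: complex poly. degree P \<ge> 2 \<longrightarrow>
            (\<exists>z. poly P z = z \<and> Re (deriv (poly P) z) \<ge> 1))"
proof (intro conjI allI impI)
  fix R :: "sphere \<Rightarrow> sphere" and d
  assume "rational_map d R \<and> d \<ge> 2 \<and> (\<exists>x. superattracting R x)"
  then show "\<exists>x. fixed_point R x \<and> Re (multiplier R x) \<ge> 1"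
    unfolding rational_map_def using superattracting_imp_weakly_repelling by blast
next
  fix P :: "complex poly"
  assume deg: "degree P \<ge> 2"
  let ?R = "rat_map P 1"
  \<comment> \<open>For the denominator 1, the coefficient of index
    \<open>degree P - 1 \<ge> 1\<close> is 0. Thus infinity is superattracting, and the fixed point
    found below, with multiplier of real part at least 1, must be finite.\<close>
  have mN: "multiplier ?R None = 0"
    using multiplier_None[of 1 P] deg by (simp add: coeff_eq_0)
  have "superattracting ?R None"
    using mN deg by (simp add: superattracting_def fixed_point_None_iff coeff_eq_0)
  then obtain y where y: "fixed_point ?R y" "Re (multiplier ?R y) \<ge> 1"
    using superattracting_imp_weakly_repelling[of P 1 "degree P" None] deg by auto
  then obtain z where z: "y = Some z" using mN by (cases y) auto
  have "multiplier ?R (Some z) = deriv (poly P) z"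
    by (simp add: multiplier_def rat_map_def)
  moreover have "poly P z = z"
    using y(1) z by (simp add: fixed_point_def rat_map_def)
  ultimately show "\<exists>z. poly P z = z \<and> Re (deriv (poly P) z) \<ge> 1"
    using y(2) z by auto
qed

end
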